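(* Let $(\delta_1,Q_1,\{v_1^{\delta_1},\ldots,v_n^{\delta_1}\})$ and $(\delta_2,Q_2,\{v_1^{\delta_2},\ldots,v_m^{\delta_2}\})$ be cone fundamental triples in $\mathbb{R}^n$ and $\mathbb{R}^m$ respectively, and let $\delta_1\to\delta_2$ be a cone morphism defined by a linear map $f\colon\mathbb{R}^n\to\mathbb{R}^m$. Let $\alpha_1^{\delta_2},\ldots,\alpha_m^{\delta_2}$ be the basis of $(\mathbb{R}^m)^*$ dual to $v_1^{\delta_2},\ldots,v_m^{\delta_2}$. Then the mapping $$\Phi_{\delta_2\delta_1}\colon X_{\delta_1}\to X_{\delta_2},\qquad [z_1:\cdots:z_n]\mapsto\left[\prod_{h=1}^n z_h^{\alpha_1^{\delta_2}(f(v_h^{\delta_1}))}:\cdots:\prod_{h=1}^n z_h^{\alpha_m^{\delta_2}(f(v_h^{\delta_1}))}\right]$$ is well defined. That is: for every $(z_1,\ldots,z_n)\in U_{\delta_1}$ all the powers involved make sense (the exponents of vanishing coordinates are non-negative), the tuple of monomials on the right lies in $U_{\delta_2}$, and its class in $X_{\delta_2}=U_{\delta_2}/\Gamma_{\delta_2}$ depends neither on the choice of logarithms used to define the real powers of the nonzero $z_h$ nor on the choice of the representative $(z_1,\ldots,z_n)$ of the point $[z_1:\cdots:z_n]\in X_{\delta_1}$.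
   Context: A quasilattice $Q$ in $\mathbb{R}^n$ is the $\mathbb{Z}$-span of a set of vectors that spans $\mathbb{R}^n$. An $r$-dimensional simplicial cone $\delta\subset\mathbb{R}^n$ ($0\le r\le n$) is the set of non-negative real combinations of $r$ linearly independent vectors (its ray generators); $\{0\}$ is the case $r=0$. A cone fundamental triple $(\delta,Q,\{v_1^\delta,\ldots,v_n^\delta\})$ in $\mathbb{R}^n$ consists of a quasilattice $Q\subset\mathbb{R}^n$, vectors $v_1^\delta,\ldots,v_n^\delta\in Q$ forming a basis of $\mathbb{R}^n$, and a simplicial cone $\delta$ whose ray generators are the $v_i^\delta$ with $i$ in a subset $I_\delta\subseteq\{1,\ldots,n\}$. Let $\alpha_1^\delta,\ldots,\alpha_n^\delta$ be the dual basis of $(\mathbb{R}^n)^*$, let $L_\delta=\bigoplus_i\mathbb{Z}v_i^\delta\subset Q$, and let $\Gamma_\delta=Q/L_\delta$. Put $U_\delta=\{z\in\mathbb{C}^n\mid z_i\neq0\text{ for all }i\notin I_\delta\}$ (which is $\mathbb{C}^r\times(\mathbb{C}^* )^{n-r}$ up to ordering of coordinates). The group $\Gamma_\delta$ acts on $U_\delta$ by $[v]\cdot(z_1,\ldots,z_n)=(e^{2\pi i\alpha_1^\delta(v)}z_1,\ldots,e^{2\pi i\alpha_n^\delta(v)}z_n)$, $v\in Q$. The affine toric quasifold of the triple is the quotient $X_\delta=U_\delta/\Gamma_\delta$; the class of $(z_1,\ldots,z_n)$ is written $[z_1:\cdots:z_n]$. A cone morphism $\delta_1\to\delta_2$ between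 cones with quasilattices $Q_1\subset\mathbb{R}^n$, $Q_2\subset\mathbb{R}^m$ is a linear map $f\colon\mathbb{R}^n\to\mathbb{R}^m$ with $f(Q_1)\subset Q_2$ and $f(\delta_1)\subset\delta_2$. Convention on real powers: for each nonzero $z_h$ choose $x_h\in\mathbb{C}$ with $z_h=e^{2\pi i x_h}$ (the same choice for all $m$ monomials) and set $z_h^a=e^{2\pi i a x_h}$ for $a\in\mathbb{R}$; if $z_h=0$, then $z_h^a=0$ for $a>0$ and $z_h^0=1$. *)

theory Defs
  imports "HOL-Analysis.Analysis"
begin

definition Z_span :: "'a::real_vector set \<Rightarrow> 'a set" where
  "Z_span S = module.span (\<lambda>(k::int) v. of_int k *\<^sub>R v) S"

lemma module_int_scaleR: "module (\<lambda>(k::int) (v::'a::real_vector). of_int k *\<^sub>R v)"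
  by unfold_locales (simp_all add: scaleR_add_right scaleR_add_left)

lemma Z_span_explicit:
  "Z_span S = {(\<Sum>a\<in>T. of_int (k a) *\<^sub>R a) | T (k :: _ \<Rightarrow> int). finite T \<and> T \<subseteq> S}"
  unfolding Z_span_def module.span_explicit[OF module_int_scaleR] by blast

definition quasilattice :: "'a::real_vector set \<Rightarrow> bool" where
  "quasilattice Q \<longleftrightarrow> (\<exists>S. span S = UNIV \<and> Q = Z_span S)"

definition nonneg_combinations :: "'a::real_vector set \<Rightarrow> 'a set" where
  "nonneg_combinations B = {(\<Sum>b\<in>B. c b *\<^sub>R b) | c. \<forall>b\<in>B. 0 \<le> c b}"

definition simplicial_cone :: "'a::euclidean_space set \<Rightarrow> 'a set \<Rightarrow> bool" where
  "simplicial_cone B \<delta> \<longleftrightarrow> independent B \<and> \<delta> = nonneg_combinations B"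

definition indexed_basis :: "('i \<Rightarrow> 'a::real_vector) \<Rightarrow> bool" where
  "indexed_basis v \<longleftrightarrow> inj v \<and> independent (range v) \<and> span (range v) = UNIV"

definition cone_fundamental_triple ::
  "(real^'n) set \<Rightarrow> (real^'n) set \<Rightarrow> ('n \<Rightarrow> real^'n) \<Rightarrow> bool" where
  "cone_fundamental_triple \<delta> Q v \<longleftrightarrow>
     quasilattice Q \<and> range v \<subseteq> Q \<and> indexed_basis v \<and> (\<exists>I. simplicial_cone (v ` I) \<delta>)"

text \<open>The index set of the rays is determined by the cone and the basis;
  see the lemmas \<open>ray_indices_eq\<close> and \<open>simplicial_cone_ray_indices\<close> below.\<close>

definition ray_indices :: "(real^'n) set \<Rightarrow> ('n \<Rightarrow> real^'n) \<Rightarrow> 'n set" where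
  "ray_indices \<delta> v = (THE I. simplicial_cone (v ` I) \<delta>)"

definition dual_basis :: "('n \<Rightarrow> real^'n) \<Rightarrow> 'n \<Rightarrow> real^'n \<Rightarrow> real" where
  "dual_basis v i = (THE a. linear a \<and> (\<forall>j. a (v j) = (if j = i then 1 else 0)))"

definition Gamma :: "(real^'n) set \<Rightarrow> ('n \<Rightarrow> real^'n) \<Rightarrow> (real^'n) set set" where
  "Gamma Q v = Q // {(p, q). p \<in> Q \<and> q \<in> Q \<and> p - q \<in> Z_span (range v)}"

definition U_set :: "(real^'n) set \<Rightarrow> ('n \<Rightarrow> real^'n) \<Rightarrow> (complex^'n) set" where
  "U_set \<delta> v = {z. \<forall>i. i \<notin> ray_indices \<delta> v \<longrightarrow> z $ i \<noteq> 0}"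

definition e2pi :: "complex \<Rightarrow> complex" where
  "e2pi w = exp (2 * of_real pi * \<i> * w)"

text \<open>A class in \<open>Gamma Q v\<close> acts through any of its representatives;
  see the lemma \<open>Gamma_act_class\<close> below.\<close>

definition Gamma_act :: "('n \<Rightarrow> real^'n) \<Rightarrow> (real^'n) set \<Rightarrow> complex^'n \<Rightarrow> complex^'n" where
  "Gamma_act v g z = (\<chi> i. e2pi (of_real (dual_basis v i (SOME q. q \<in> g))) * z $ i)"

definition orbit_rel ::
  "(real^'n) set \<Rightarrow> (real^'n) set \<Rightarrow> ('n \<Rightarrow> real^'n) \<Rightarrow> ((complex^'n) \<times> (complex^'n)) set" where
  "orbit_rel \<delta> Q v =
     {(z, w). z \<in> U_set \<delta> v \<and> w \<in> U_set \<delta> v \<and> (\<exists>g \<in> Gamma Q v. w = Gamma_act v g z)}"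

definition toric_quasifold ::
  "(real^'n) set \<Rightarrow> (real^'n) set \<Rightarrow> ('n \<Rightarrow> real^'n) \<Rightarrow> (complex^'n) set set" where
  "toric_quasifold \<delta> Q v = U_set \<delta> v // orbit_rel \<delta> Q v"

definition point_class ::
  "(real^'n) set \<Rightarrow> (real^'n) set \<Rightarrow> ('n \<Rightarrow> real^'n) \<Rightarrow> complex^'n \<Rightarrow> (complex^'n) set" where
  "point_class \<delta> Q v z = orbit_rel \<delta> Q v `` {z}"

definition cone_morphism ::
  "(real^'n) set \<Rightarrow> (real^'n) set \<Rightarrow> (real^'m) set \<Rightarrow> (real^'m) set \<Rightarrow> (real^'n \<Rightarrow> real^'m) \<Rightarrow> bool" where
  "cone_morphism \<delta>1 Q1 \<delta>2 Q2 f \<longleftrightarrow> linear f \<and> f ` Q1 \<subseteq> Q2 \<and> f ` \<delta>1 \<subseteq> \<delta>2"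

definition log_choice :: "complex^'n \<Rightarrow> complex^'n \<Rightarrow> bool" where
  "log_choice z x \<longleftrightarrow> (\<forall>h. z $ h \<noteq> 0 \<longrightarrow> z $ h = e2pi (x $ h))"

text \<open>The real power of \<open>z\<close> with exponent \<open>a\<close>, formed with the logarithm \<open>x\<close>;
  it has no meaning for \<open>z = 0\<close> and \<open>a < 0\<close>.\<close>

definition real_power :: "complex \<Rightarrow> complex \<Rightarrow> real \<Rightarrow> complex" where
  "real_power z x a =
     (if z \<noteq> 0 then e2pi (of_real a * x)
      else if a > 0 then 0
      else if a = 0 then 1
      else undefined)"

definition monomial_tuple ::
  "(real^'n \<Rightarrow> real^'m) \<Rightarrow> ('n \<Rightarrow> real^'n) \<Rightarrow> ('m \<Rightarrow> real^'m) \<Rightarrow> complex^'n \<Rightarrow> complex^'n \<Rightarrow> complex^'m"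
  where
  "monomial_tuple f v1 v2 z x =
     (\<chi> j. \<Prod>h\<in>UNIV. real_power (z $ h) (x $ h) (dual_basis v2 j (f (v1 h))))"


lemma dual_basis_exists_unique:
  assumes "indexed_basis v"
  shows "\<exists>!a :: real^'n \<Rightarrow> real. linear a \<and> (\<forall>j. a (v j) = (if j = i then 1 else 0))"
proof (rule ex_ex1I)
  obtain a :: "real^'n \<Rightarrow> real" where a: "linear a"
    "\<forall>x\<in>range v. a x = (if inv v x = i then 1 else 0)"
    using linear_independent_extend[of "range v" "\<lambda>x. if inv v x = i then 1 else (0::real)"] assms
    unfolding indexed_basis_def by blast
  then show "\<exists>a :: real^'n \<Rightarrow> real. linear a \<and> (\<forall>j. a (v j) = (if j = i then 1 else 0))"
    using assms unfolding indexed_basis_def by (intro exI[of _ a]) auto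
next
  fix a b :: "real^'n \<Rightarrow> real"
  assume "linear a \<and> (\<forall>j. a (v j) = (if j = i then 1 else 0))"
    and "linear b \<and> (\<forall>j. b (v j) = (if j = i then 1 else 0))"
  then show "a = b"
    using linear_eq_on_span[of a b "range v"] assms unfolding indexed_basis_def by fastforce
qed

lemma dual_basis:
  assumes "indexed_basis v"
  shows "linear (dual_basis v i)" "dual_basis v i (v j) = (if j = i then 1 else 0)"
  using theI'[OF dual_basis_exists_unique[OF assms, of i]] unfolding dual_basis_def by auto

lemma nonneg_combinations_image:
  fixes v :: "'n::finite \<Rightarrow> real^'n"
  assumes v: "indexed_basis v"
  shows "v i \<in> nonneg_combinations (v ` I) \<longleftrightarrow> i \<in> I"
proof
  assume "v i \<in> nonneg_combinations (v ` I)"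
  then obtain c where "v i = (\<Sum>b\<in>v ` I. c b *\<^sub>R b)"
    unfolding nonneg_combinations_def by blast
  moreover have "(\<Sum>b\<in>v ` I. c b *\<^sub>R b) \<in> span (v ` I)"
    by (intro span_sum span_scale span_base)
  ultimately have "v i \<in> span (v ` I)"
    by simp
  then have *: "dual_basis v i (v i) = 0" if "i \<notin> I"
    using linear_eq_0_on_span[OF dual_basis(1)[OF v, of i], of "v ` I"] that dual_basis(2)[OF v]
    by (metis (no_types, lifting) imageE)
  show "i \<in> I" using * dual_basis(2)[OF v, of i i] by auto
next
  assume "i \<in> I"
  then have "v i = (\<Sum>b\<in>v ` I. (if b = v i then 1 else 0) *\<^sub>R b)"
    by (simp add: if_distrib[of "\<lambda>c. c *\<^sub>R _"] sum.delta cong: if_cong)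
  then show "v i \<in> nonneg_combinations (v ` I)"
    unfolding nonneg_combinations_def
    by (intro CollectI exI[of _ "\<lambda>b. if b = v i then 1 else 0"]) auto
qed

lemma ray_indices_eq:
  assumes "indexed_basis v" "simplicial_cone (v ` I) \<delta>"
  shows "ray_indices \<delta> v = I"
  unfolding ray_indices_def
proof (rule the_equality)
  fix J assume "simplicial_cone (v ` J) \<delta>"
  then show "J = I"
    using assms(2) nonneg_combinations_image[OF assms(1)]
    unfolding simplicial_cone_def by blast
qed fact

lemma simplicial_cone_ray_indices:
  assumes "cone_fundamental_triple \<delta> Q v"
  shows "simplicial_cone (v ` ray_indices \<delta> v) \<delta>"
  using assms ray_indices_eq unfolding cone_fundamental_triple_def by metis

lemma dual_basis_Z_span:
  assumes v: "indexed_basis v" and "u \<in> Z_span (range v)"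
  shows "dual_basis v i u \<in> \<int>"
proof -
  obtain T k where "T \<subseteq> range v" and u: "u = (\<Sum>a\<in>T. of_int (k a :: int) *\<^sub>R a)"
    using assms(2) unfolding Z_span_explicit by blast
  then have "dual_basis v i a \<in> \<int>" if "a \<in> T" for a
    using that dual_basis(2)[OF v] by auto
  then show ?thesis
    unfolding u linear_sum[OF dual_basis(1)[OF v]] linear_cmul[OF dual_basis(1)[OF v]]
    by (auto intro!: Ints_sum)
qed

lemma Gamma_act_class:
  assumes "indexed_basis v" "q \<in> Q"
  shows "Gamma_act v ({(p, q). p \<in> Q \<and> q \<in> Q \<and> p - q \<in> Z_span (range v)} `` {q}) z
       = (\<chi> i. e2pi (of_real (dual_basis v i q)) * z $ i)"
proof -
  let ?g = "{(p, q). p \<in> Q \<and> q \<in> Q \<and> p - q \<in> Z_span (range v)} `` {q}"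
  define p where "p = (SOME p. p \<in> ?g)"
  have "0 \<in> Z_span (range v)"
    unfolding Z_span_explicit by (intro CollectI exI[of _ "{}"]) auto
  then have "q \<in> ?g"
    using assms(2) by simp
  then have "p \<in> ?g"
    unfolding p_def by (rule someI)
  then have d: "q - p \<in> Z_span (range v)"
    by simp
  have "e2pi (of_real (dual_basis v i p)) = e2pi (of_real (dual_basis v i q))" for i
  proof -
    obtain k where "dual_basis v i q - dual_basis v i p = of_int k"
      using dual_basis_Z_span[OF assms(1) d, of i] linear_diff[OF dual_basis(1)[OF assms(1)]]
      by (metis Ints_cases)
    then have "dual_basis v i q = dual_basis v i p + of_int k"
      by simp
    then show ?thesis
      unfolding e2pi_def exp_eq
      by (intro exI[of _ "- k"]) (simp add: algebra_simps)
  qed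
  then show ?thesis
    unfolding Gamma_act_def p_def by simp
qed

end

theory Submission
  imports Defs
begin

text \<open>If \<open>z'\<close> is the image of \<open>z\<close> under the class of \<open>q \<in> Q\<^sub>1\<close>, then any logarithms of the
  nonzero coordinates satisfy \<open>x'\<^sub>h = x\<^sub>h + \<alpha>\<^sub>h(q) + k\<^sub>h\<close> with integers \<open>k\<^sub>h\<close>.
  So \<open>p = q + \<Sum>\<^sub>h k\<^sub>h v\<^sub>h\<close> absorbs both the change of representative and the change of logarithms;
  it lies in \<open>Q\<^sub>1\<close>, and the \<open>j\<close>-th monomial is multiplied by the exponential of
  \<open>\<Sum>\<^sub>h \<alpha>\<^sub>j(f(v\<^sub>h)) \<alpha>\<^sub>h(p) = \<alpha>\<^sub>j(f(p))\<close>, which is the action of \<open>f(p) \<in> Q\<^sub>2\<close>.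
  The zero coordinates cause no trouble because \<open>f\<close> maps the rays of the first cone into the
  second one.\<close>

section \<open>The exponential \<open>e2pi\<close> and its logarithms\<close>

lemma e2pi_add: "e2pi (a + b) = e2pi a * e2pi b"
  by (simp add: e2pi_def distrib_left exp_add)

lemma e2pi_0 [simp]: "e2pi 0 = 1"
  by (simp add: e2pi_def)

lemma e2pi_nonzero [simp]: "e2pi a \<noteq> 0"
  by (simp add: e2pi_def)

lemma e2pi_sum: "e2pi (sum g A) = (\<Prod>a\<in>A. e2pi (g a))"
  \<comment> \<open>For infinite \<open>A\<close> the sum defaults to 0 and the product to 1,
    matching \<open>e2pi 0 = 1\<close>.\<close>
  by (induction A rule: infinite_finite_induct) (simp_all add: e2pi_add)

text \<open>The kernel of \<open>e2pi\<close> is the integers. This is where the integers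
  \<open>k h\<close> in the comparison of logarithms come from.\<close>

lemma e2pi_eq_imp:
  assumes "e2pi a = e2pi b"
  obtains k :: int where "a = b + of_int k"
proof -
  obtain k :: int where
    "2 * of_real pi * \<i> * a = 2 * of_real pi * \<i> * b + of_int (2 * k) * of_real pi * \<i>"
    using assms unfolding e2pi_def exp_eq by auto
  then have "(2 * of_real pi * \<i>) * a = (2 * of_real pi * \<i>) * (b + of_int k)"
    by (simp add: algebra_simps)
  then have "a = b + of_int k"
    by (subst (asm) mult_cancel_left) simp
  then show ?thesis by (rule that)
qed

lemma e2pi_surj:
  assumes "z \<noteq> 0"
  shows "\<exists>x. z = e2pi x"
  using assms by (intro exI[of _ "Ln z / (2 * of_real pi * \<i>)"]) (simp add: e2pi_def)

text \<open>Ensures that conditions quantified over logarithms are never vacuous; both existence and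
  uniqueness of the induced map rely on this. At a zero coordinate \<open>log_choice\<close> imposes
  nothing, so the arbitrary value of \<open>SOME\<close> is harmless there.\<close>

lemma log_choice_exists: "\<exists>x. log_choice z x"
  unfolding log_choice_def using e2pi_surj
  by (intro exI[of _ "\<chi> h. SOME x. z $ h = e2pi x"]) (auto intro: someI_ex)

section \<open>Quasilattices as additive groups\<close>

lemma quasilattice_0: "quasilattice Q \<Longrightarrow> 0 \<in> Q"
  using module.span_zero[OF module_int_scaleR] by (auto simp: quasilattice_def Z_span_def)

lemma quasilattice_add: "quasilattice Q \<Longrightarrow> p \<in> Q \<Longrightarrow> q \<in> Q \<Longrightarrow> p + q \<in> Q"
  using module.span_add[OF module_int_scaleR] by (auto simp: quasilattice_def Z_span_def)

lemma quasilattice_scale: "quasilattice Q \<Longrightarrow> q \<in> Q \<Longrightarrow> of_int k *\<^sub>R q \<in> Q"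
  using module.span_scale[OF module_int_scaleR] by (auto simp: quasilattice_def Z_span_def)

lemma quasilattice_minus: "quasilattice Q \<Longrightarrow> q \<in> Q \<Longrightarrow> - q \<in> Q"
  using quasilattice_scale[of Q q "-1"] by simp

lemma quasilattice_sum:
  "quasilattice Q \<Longrightarrow> (\<And>a. a \<in> A \<Longrightarrow> g a \<in> Q) \<Longrightarrow> sum g A \<in> Q"
  by (induction A rule: infinite_finite_induct) (auto intro: quasilattice_0 quasilattice_add)

section \<open>Coordinates with respect to a dual basis\<close>

lemma dual_basis_sum_scaleR:
  assumes "indexed_basis v"
  shows "dual_basis v i (\<Sum>h\<in>UNIV. c h *\<^sub>R v h) = c i"
  by (simp add: linear_sum[OF dual_basis(1)[OF assms]] linear_cmul[OF dual_basis(1)[OF assms]]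
      dual_basis(2)[OF assms] if_distrib cong: if_cong)

text \<open>Both sides are linear in \<open>u\<close> and agree on the basis vectors.\<close>

lemma dual_basis_expansion:
  assumes v: "indexed_basis v"
  shows "(\<Sum>h\<in>UNIV. dual_basis v h u *\<^sub>R v h) = u"
proof -
  have "u \<in> span (range v)"
    using v by (simp add: indexed_basis_def)
  moreover have "linear (\<lambda>u. \<Sum>h\<in>UNIV. dual_basis v h u *\<^sub>R v h)"
    by (intro linear_compose_sum ballI linearI)
       (simp_all add: linear_add[OF dual_basis(1)[OF v]] linear_cmul[OF dual_basis(1)[OF v]]
          scaleR_add_left)
  moreover have "(\<Sum>h\<in>UNIV. dual_basis v h a *\<^sub>R v h) = a" if "a \<in> range v" for a
    using that
    by (auto simp: dual_basis(2)[OF v] if_distrib[of "\<lambda>c. c *\<^sub>R _"] cong: if_cong)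
  ultimately show ?thesis
    using linear_eq_on_span[OF _ linear_ident] by blast
qed

text \<open>On a conic combination of the \<open>v i\<close> with \<open>i\<close> in
  \<open>I\<close>, the form \<open>dual_basis v j\<close> reads off the coefficient of
  \<open>v j\<close>. The sign gives meaningful exponents; the vanishing off \<open>I\<close> keeps
  the required coordinates nonzero.\<close>

lemma dual_basis_simplicial_cone:
  assumes v: "indexed_basis v" and I: "simplicial_cone (v ` I) \<delta>" and u: "u \<in> \<delta>"
  shows "0 \<le> dual_basis v j u" "j \<notin> I \<Longrightarrow> dual_basis v j u = 0"
proof -
  obtain c where c: "\<forall>b\<in>v ` I. 0 \<le> c b" and "u = (\<Sum>b\<in>v ` I. c b *\<^sub>R b)"
    using I u unfolding simplicial_cone_def nonneg_combinations_def by blast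
  then have *: "dual_basis v j u = (\<Sum>b\<in>v ` I. c b * dual_basis v j b)"
    by (simp add: linear_sum[OF dual_basis(1)[OF v]] linear_cmul[OF dual_basis(1)[OF v]])
  show "0 \<le> dual_basis v j u"
    unfolding * using c dual_basis(2)[OF v] by (intro sum_nonneg) auto
  show "dual_basis v j u = 0" if "j \<notin> I"
    unfolding * using that dual_basis(2)[OF v] by (intro sum.neutral) auto
qed

section \<open>Orbits of the group action and points of the quasifold\<close>

text \<open>Trades classes in \<open>Gamma Q v\<close> for vectors of \<open>Q\<close>: by
  \<open>Gamma_act_class\<close> a class acts through any representative. Later arguments on orbits
  work with vectors only.\<close>

lemma orbit_rel_iff:
  assumes "cone_fundamental_triple \<delta> Q v"
  shows "(z, w) \<in> orbit_rel \<delta> Q v \<longleftrightarrow> z \<in> U_set \<delta> v \<and> w \<in> U_set \<delta> v \<and>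
    (\<exists>q\<in>Q. w = (\<chi> i. e2pi (of_real (dual_basis v i q)) * z $ i))"
proof -
  have "indexed_basis v"
    using assms by (simp add: cone_fundamental_triple_def)
  then have *: "(\<exists>q\<in>Q. w = Gamma_act v
        ({(p, q). p \<in> Q \<and> q \<in> Q \<and> p - q \<in> Z_span (range v)} `` {q}) z) \<longleftrightarrow>
      (\<exists>q\<in>Q. w = (\<chi> i. e2pi (of_real (dual_basis v i q)) * z $ i))"
    by (intro bex_cong refl) (subst Gamma_act_class, auto)
  have "(\<exists>g\<in>Gamma Q v. w = Gamma_act v g z) \<longleftrightarrow>
      (\<exists>q\<in>Q. w = (\<chi> i. e2pi (of_real (dual_basis v i q)) * z $ i))"
    unfolding *[symmetric] Gamma_def quotient_def by blast
  then show ?thesis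
    by (simp add: orbit_rel_def)
qed

text \<open>The group structure of \<open>Q\<close> is carried over by linearity of the dual basis:
  0 gives reflexivity, \<open>- q\<close> symmetry and \<open>p + q\<close> transitivity.\<close>

lemma equiv_orbit_rel:
  assumes T: "cone_fundamental_triple \<delta> Q v"
  shows "equiv (U_set \<delta> v) (orbit_rel \<delta> Q v)"
proof (rule equivI)
  have Q: "quasilattice Q" and v: "indexed_basis v"
    using T by (simp_all add: cone_fundamental_triple_def)
  note lin = dual_basis(1)[OF v]
  show "orbit_rel \<delta> Q v \<subseteq> U_set \<delta> v \<times> U_set \<delta> v"
    by (auto simp: orbit_rel_def)
  show "refl_on (U_set \<delta> v) (orbit_rel \<delta> Q v)"
    by (rule refl_onI)
       (auto simp: orbit_rel_iff[OF T] linear_0[OF lin] intro!: bexI[OF _ quasilattice_0[OF Q]])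
  show "sym (orbit_rel \<delta> Q v)"
  proof (rule symI)
    fix z w assume "(z, w) \<in> orbit_rel \<delta> Q v"
    then obtain q where q: "z \<in> U_set \<delta> v" "w \<in> U_set \<delta> v" "q \<in> Q"
        "w = (\<chi> i. e2pi (of_real (dual_basis v i q)) * z $ i)"
      unfolding orbit_rel_iff[OF T] by blast
    have "z = (\<chi> i. e2pi (of_real (dual_basis v i (- q))) * w $ i)"
      using q(4) by (simp add: vec_eq_iff linear_neg[OF lin] mult.assoc[symmetric]
          e2pi_add[symmetric])
    then show "(w, z) \<in> orbit_rel \<delta> Q v"
      unfolding orbit_rel_iff[OF T] using q quasilattice_minus[OF Q] by blast
  qed
  show "trans (orbit_rel \<delta> Q v)"
  proof (rule transI)
    fix z w y assume "(z, w) \<in> orbit_rel \<delta> Q v" "(w, y) \<in> orbit_rel \<delta> Q v"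
    then obtain p q where pq: "z \<in> U_set \<delta> v" "y \<in> U_set \<delta> v" "p \<in> Q" "q \<in> Q"
        "w = (\<chi> i. e2pi (of_real (dual_basis v i p)) * z $ i)"
        "y = (\<chi> i. e2pi (of_real (dual_basis v i q)) * w $ i)"
      unfolding orbit_rel_iff[OF T] by blast
    have "y = (\<chi> i. e2pi (of_real (dual_basis v i (p + q))) * z $ i)"
      using pq(5,6) by (simp add: vec_eq_iff linear_add[OF lin] e2pi_add mult_ac)
    then show "(z, y) \<in> orbit_rel \<delta> Q v"
      unfolding orbit_rel_iff[OF T] using pq quasilattice_add[OF Q] by blast
  qed
qed

lemma point_class_eq_iff:
  assumes "cone_fundamental_triple \<delta> Q v" "z \<in> U_set \<delta> v" "w \<in> U_set \<delta> v"
  shows "point_class \<delta> Q v z = point_class \<delta> Q v w \<longleftrightarrow> (z, w) \<in> orbit_rel \<delta> Q v"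
  unfolding point_class_def by (rule eq_equiv_class_iff[OF equiv_orbit_rel]) (use assms in auto)

lemma toric_quasifold_eq_image: "toric_quasifold \<delta> Q v = point_class \<delta> Q v ` U_set \<delta> v"
  by (auto simp: toric_quasifold_def quotient_def point_class_def)

text \<open>The hypothesis on zero coordinates is needed because \<^const>\<open>real_power\<close> is unspecified at
  \<open>0\<close> for negative exponents.\<close>

lemma real_power_shift:
  assumes "z = 0 \<Longrightarrow> 0 \<le> a" "z' = 0 \<longleftrightarrow> z = 0" "z \<noteq> 0 \<Longrightarrow> x' = x + of_real t"
  shows "real_power z' x' a = e2pi (of_real (a * t)) * real_power z x a"
  using assms by (cases "z = 0") (auto simp: real_power_def e2pi_add[symmetric] algebra_simps)

section \<open>The monomial map of a cone morphism\<close>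

context
  fixes \<delta>1 Q1 :: "(real^'n) set" and v1 :: "'n \<Rightarrow> real^'n"
    and \<delta>2 Q2 :: "(real^'m) set" and v2 :: "'m \<Rightarrow> real^'m"
    and f :: "real^'n \<Rightarrow> real^'m"
  assumes T1: "cone_fundamental_triple \<delta>1 Q1 v1"
    and T2: "cone_fundamental_triple \<delta>2 Q2 v2"
    and mor: "cone_morphism \<delta>1 Q1 \<delta>2 Q2 f"
begin

text \<open>Points of \<open>U_set\<close> can vanish only at ray indices, so \<open>v1 h\<close> is
  a ray generator of the first cone, and \<open>f\<close> carries that cone into the second.\<close>

lemma cone_morphism_ray:
  assumes "z \<in> U_set \<delta>1 v1" "z $ h = 0"
  shows "f (v1 h) \<in> \<delta>2"
proof -
  have "h \<in> ray_indices \<delta>1 v1"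
    using assms by (auto simp: U_set_def)
  then have "v1 h \<in> \<delta>1"
    using simplicial_cone_ray_indices[OF T1] T1 nonneg_combinations_image
    unfolding simplicial_cone_def cone_fundamental_triple_def by blast
  then show ?thesis
    using mor unfolding cone_morphism_def by blast
qed

lemma exponent_nonneg:
  assumes "z \<in> U_set \<delta>1 v1" "z $ h = 0"
  shows "0 \<le> dual_basis v2 j (f (v1 h))"
  using dual_basis_simplicial_cone(1)[OF _ simplicial_cone_ray_indices[OF T2]]
    cone_morphism_ray[OF assms] T2 unfolding cone_fundamental_triple_def by blast

text \<open>Factors with \<open>z $ h \<noteq> 0\<close> are exponentials. If
  \<open>z $ h = 0\<close>, then \<open>f (v1 h)\<close> lies in the second cone, on which the dual
  form of a non-ray index vanishes, so the factor is 0 to the power 0, which is 1.\<close>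

lemma monomial_tuple_in_U_set:
  assumes "z \<in> U_set \<delta>1 v1"
  shows "monomial_tuple f v1 v2 z x \<in> U_set \<delta>2 v2"
proof -
  have "real_power (z $ h) (x $ h) (dual_basis v2 j (f (v1 h))) \<noteq> 0"
    if "j \<notin> ray_indices \<delta>2 v2" for j h
  proof (cases "z $ h = 0")
    case True
    have "dual_basis v2 j (f (v1 h)) = 0"
      using dual_basis_simplicial_cone(2)[OF _ simplicial_cone_ray_indices[OF T2] _ that]
        cone_morphism_ray[OF assms True] T2 unfolding cone_fundamental_triple_def by blast
    then show ?thesis
      using True by (simp add: real_power_def)
  qed (simp add: real_power_def)
  then show ?thesis
    by (simp add: U_set_def monomial_tuple_def)
qed

text \<open>The logarithms \<open>x\<close> and \<open>x'\<close> are chosen independently, so the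
  case \<open>z' = z\<close> already contains independence of the logarithm.\<close>

lemma monomial_tuple_orbit_rel:
  assumes rel: "(z, z') \<in> orbit_rel \<delta>1 Q1 v1" and x: "log_choice z x" and x': "log_choice z' x'"
  shows "(monomial_tuple f v1 v2 z x, monomial_tuple f v1 v2 z' x') \<in> orbit_rel \<delta>2 Q2 v2"
proof -
  have Q1: "quasilattice Q1" "range v1 \<subseteq> Q1" and v1: "indexed_basis v1" and v2: "indexed_basis v2"
    using T1 T2 by (simp_all add: cone_fundamental_triple_def)
  have f: "linear f" "f ` Q1 \<subseteq> Q2"
    using mor by (simp_all add: cone_morphism_def)
  note lin1 = dual_basis(1)[OF v1] and lin2 = dual_basis(1)[OF v2]
  obtain q where z: "z \<in> U_set \<delta>1 v1" and z': "z' \<in> U_set \<delta>1 v1" and q: "q \<in> Q1"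
    and z'_eq: "\<And>h. z' $ h = e2pi (of_real (dual_basis v1 h q)) * z $ h"
    using rel unfolding orbit_rel_iff[OF T1] by auto
  \<comment> \<open>The integer is constrained only where \<open>z $ h\<close> is nonzero. Elsewhere
    any value will do, since the monomial factors at zero coordinates do not see the
    logarithm.\<close>
  have "\<exists>k :: int. z $ h \<noteq> 0 \<longrightarrow> x' $ h = x $ h + of_real (dual_basis v1 h q + of_int k)" for h
  proof (cases "z $ h = 0")
    case False
    then have "e2pi (x' $ h) = e2pi (of_real (dual_basis v1 h q) + x $ h)"
      using x x' z'_eq[of h] by (auto simp: log_choice_def e2pi_add)
    then show ?thesis
      by (rule e2pi_eq_imp) (auto simp: algebra_simps)
  qed simp
  then obtain k :: "'n \<Rightarrow> int" where
    k: "\<And>h. z $ h \<noteq> 0 \<Longrightarrow> x' $ h = x $ h + of_real (dual_basis v1 h q + of_int (k h))"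
    by metis
  define p where "p = q + (\<Sum>h\<in>UNIV. of_int (k h) *\<^sub>R v1 h)"
  have "p \<in> Q1"
    unfolding p_def using Q1 q
    by (intro quasilattice_add quasilattice_sum quasilattice_scale) auto
  have p: "dual_basis v1 h p = dual_basis v1 h q + of_int (k h)" for h
    by (simp add: p_def linear_add[OF lin1] dual_basis_sum_scaleR[OF v1])
  \<comment> \<open>Expand \<open>p\<close> in the basis \<open>v1\<close>, then apply
    \<open>f\<close> and the dual form of \<open>v2\<close>.\<close>
  have fp: "dual_basis v2 j (f p) = (\<Sum>h\<in>UNIV. dual_basis v2 j (f (v1 h)) * dual_basis v1 h p)" for j
  proof -
    have "dual_basis v2 j (f p) = dual_basis v2 j (f (\<Sum>h\<in>UNIV. dual_basis v1 h p *\<^sub>R v1 h))"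
      by (simp add: dual_basis_expansion[OF v1])
    then show ?thesis
      by (simp add: linear_sum[OF f(1)] linear_cmul[OF f(1)] linear_sum[OF lin2]
          linear_cmul[OF lin2] mult.commute)
  qed
  \<comment> \<open>This holds at zero coordinates too: for a positive exponent both sides are 0,
    and for exponent 0 the extra factor is \<open>e2pi 0 = 1\<close>.\<close>
  have "real_power (z' $ h) (x' $ h) (dual_basis v2 j (f (v1 h))) =
      e2pi (of_real (dual_basis v2 j (f (v1 h)) * dual_basis v1 h p)) *
      real_power (z $ h) (x $ h) (dual_basis v2 j (f (v1 h)))" for h j
    using exponent_nonneg[OF z] k z'_eq by (intro real_power_shift) (auto simp: p)
  then have "monomial_tuple f v1 v2 z' x' =
      (\<chi> j. e2pi (of_real (dual_basis v2 j (f p))) * monomial_tuple f v1 v2 z x $ j)"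
    by (simp add: monomial_tuple_def vec_eq_iff prod.distrib fp e2pi_sum
        del: of_real_mult)
  then show ?thesis
    unfolding orbit_rel_iff[OF T2]
    using f(2) \<open>p \<in> Q1\<close> monomial_tuple_in_U_set z z' by blast
qed

lemma monomial_tuple_point_class:
  assumes "z \<in> U_set \<delta>1 v1" "z' \<in> U_set \<delta>1 v1" "log_choice z x" "log_choice z' x'"
    and "point_class \<delta>1 Q1 v1 z = point_class \<delta>1 Q1 v1 z'"
  shows "point_class \<delta>2 Q2 v2 (monomial_tuple f v1 v2 z x) =
    point_class \<delta>2 Q2 v2 (monomial_tuple f v1 v2 z' x')"
  using assms by (simp add: point_class_eq_iff T1 T2 monomial_tuple_in_U_set
      monomial_tuple_orbit_rel)

text \<open>Existence: evaluate the monomials at a chosen representative and logarithm, which is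
  harmless by \<open>monomial_tuple_point_class\<close>. Uniqueness: every point has a
  representative, and every representative has a logarithm.\<close>

lemma toric_map_unique_existence:
  "\<exists>!\<Phi>. \<Phi> \<in> toric_quasifold \<delta>1 Q1 v1 \<rightarrow>\<^sub>E toric_quasifold \<delta>2 Q2 v2 \<and>
     (\<forall>z \<in> U_set \<delta>1 v1. \<forall>x. log_choice z x \<longrightarrow>
        \<Phi> (point_class \<delta>1 Q1 v1 z) = point_class \<delta>2 Q2 v2 (monomial_tuple f v1 v2 z x))"
proof (rule ex_ex1I)
  define l :: "complex^'n \<Rightarrow> complex^'n" where "l z = (SOME x. log_choice z x)" for z
  have l: "log_choice z (l z)" for z
    unfolding l_def using log_choice_exists by (rule someI_ex)
  define r where "r = inv_into (U_set \<delta>1 v1) (point_class \<delta>1 Q1 v1)"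
  have r: "r X \<in> U_set \<delta>1 v1" "point_class \<delta>1 Q1 v1 (r X) = X"
    if "X \<in> toric_quasifold \<delta>1 Q1 v1" for X
    unfolding r_def using inv_into_into f_inv_into_f that[unfolded toric_quasifold_eq_image]
    by metis+
  \<comment> \<open>The restriction fixes the value off the quasifold, as membership in the
    extensional function space requires.\<close>
  define \<Phi> where "\<Phi> = (\<lambda>X\<in>toric_quasifold \<delta>1 Q1 v1.
    point_class \<delta>2 Q2 v2 (monomial_tuple f v1 v2 (r X) (l (r X))))"
  have "\<Phi> \<in> toric_quasifold \<delta>1 Q1 v1 \<rightarrow>\<^sub>E toric_quasifold \<delta>2 Q2 v2"
    unfolding \<Phi>_def restrict_PiE_iff toric_quasifold_eq_image[of \<delta>2]
    by (intro ballI imageI monomial_tuple_in_U_set r(1))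
  moreover have "\<Phi> (point_class \<delta>1 Q1 v1 z) = point_class \<delta>2 Q2 v2 (monomial_tuple f v1 v2 z x)"
    if "z \<in> U_set \<delta>1 v1" "log_choice z x" for z x
  proof -
    have X: "point_class \<delta>1 Q1 v1 z \<in> toric_quasifold \<delta>1 Q1 v1"
      using that by (simp add: toric_quasifold_eq_image)
    show ?thesis
      using X monomial_tuple_point_class[OF r(1)[OF X] that(1) l that(2) r(2)[OF X]]
      by (simp add: \<Phi>_def)
  qed
  ultimately show "\<exists>\<Phi>. \<Phi> \<in> toric_quasifold \<delta>1 Q1 v1 \<rightarrow>\<^sub>E toric_quasifold \<delta>2 Q2 v2 \<and>
     (\<forall>z \<in> U_set \<delta>1 v1. \<forall>x. log_choice z x \<longrightarrow>
        \<Phi> (point_class \<delta>1 Q1 v1 z) = point_class \<delta>2 Q2 v2 (monomial_tuple f v1 v2 z x))"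
    by blast
next
  fix \<Phi> \<Psi>
  assume \<Phi>: "\<Phi> \<in> toric_quasifold \<delta>1 Q1 v1 \<rightarrow>\<^sub>E toric_quasifold \<delta>2 Q2 v2 \<and>
     (\<forall>z \<in> U_set \<delta>1 v1. \<forall>x. log_choice z x \<longrightarrow>
        \<Phi> (point_class \<delta>1 Q1 v1 z) = point_class \<delta>2 Q2 v2 (monomial_tuple f v1 v2 z x))"
    and \<Psi>: "\<Psi> \<in> toric_quasifold \<delta>1 Q1 v1 \<rightarrow>\<^sub>E toric_quasifold \<delta>2 Q2 v2 \<and>
     (\<forall>z \<in> U_set \<delta>1 v1. \<forall>x. log_choice z x \<longrightarrow>
        \<Psi> (point_class \<delta>1 Q1 v1 z) = point_class \<delta>2 Q2 v2 (monomial_tuple f v1 v2 z x))"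
  show "\<Phi> = \<Psi>"
  proof (rule PiE_ext[OF conjunct1[OF \<Phi>] conjunct1[OF \<Psi>]])
    show "\<Phi> X = \<Psi> X" if "X \<in> toric_quasifold \<delta>1 Q1 v1" for X
    proof -
      obtain z where "z \<in> U_set \<delta>1 v1" "X = point_class \<delta>1 Q1 v1 z"
        using \<open>X \<in> _\<close> unfolding toric_quasifold_eq_image by blast
      then show ?thesis
        using \<Phi> \<Psi> log_choice_exists[of z] by metis
    qed
  qed
qed

end

theorem theorem3p1:
  fixes \<delta>1 Q1 :: "(real^'n) set" and v1 :: "'n \<Rightarrow> real^'n"
    and \<delta>2 Q2 :: "(real^'m) set" and v2 :: "'m \<Rightarrow> real^'m"
    and f :: "real^'n \<Rightarrow> real^'m"
  assumes "cone_fundamental_triple \<delta>1 Q1 v1"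
    and "cone_fundamental_triple \<delta>2 Q2 v2"
    and "cone_morphism \<delta>1 Q1 \<delta>2 Q2 f"
  shows
    "(\<forall>z \<in> U_set \<delta>1 v1. \<forall>h j. z $ h = 0 \<longrightarrow> 0 \<le> dual_basis v2 j (f (v1 h))) \<and>
     (\<forall>z \<in> U_set \<delta>1 v1. \<forall>x. log_choice z x \<longrightarrow> monomial_tuple f v1 v2 z x \<in> U_set \<delta>2 v2) \<and>
     (\<forall>z \<in> U_set \<delta>1 v1. \<forall>z' \<in> U_set \<delta>1 v1. \<forall>x x'.
        log_choice z x \<and> log_choice z' x' \<and>
        point_class \<delta>1 Q1 v1 z = point_class \<delta>1 Q1 v1 z' \<longrightarrow>
        point_class \<delta>2 Q2 v2 (monomial_tuple f v1 v2 z x) =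
        point_class \<delta>2 Q2 v2 (monomial_tuple f v1 v2 z' x')) \<and>
     (\<exists>!\<Phi>. \<Phi> \<in> toric_quasifold \<delta>1 Q1 v1 \<rightarrow>\<^sub>E toric_quasifold \<delta>2 Q2 v2 \<and>
        (\<forall>z \<in> U_set \<delta>1 v1. \<forall>x. log_choice z x \<longrightarrow>
           \<Phi> (point_class \<delta>1 Q1 v1 z) = point_class \<delta>2 Q2 v2 (monomial_tuple f v1 v2 z x)))"
proof (intro conjI ballI allI impI)
  show "0 \<le> dual_basis v2 j (f (v1 h))" if "z \<in> U_set \<delta>1 v1" "z $ h = 0" for z h j
    by (rule exponent_nonneg[OF assms that])
  show "monomial_tuple f v1 v2 z x \<in> U_set \<delta>2 v2" if "z \<in> U_set \<delta>1 v1" for z x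
    by (rule monomial_tuple_in_U_set[OF assms that])
  show "point_class \<delta>2 Q2 v2 (monomial_tuple f v1 v2 z x) =
      point_class \<delta>2 Q2 v2 (monomial_tuple f v1 v2 z' x')"
    if "z \<in> U_set \<delta>1 v1" "z' \<in> U_set \<delta>1 v1"
      "log_choice z x \<and> log_choice z' x' \<and> point_class \<delta>1 Q1 v1 z = point_class \<delta>1 Q1 v1 z'"
    for z z' x x'
    using that by (intro monomial_tuple_point_class[OF assms]) auto
qed (rule toric_map_unique_existence[OF assms])

end
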